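(* For every integer $n\geqslant 0$ and every $r\in\{1,2\}$, $$p(n-r)=(-1)^{r-1}\sum_{\substack{(t_r,t_{r+1},\ldots,t_n)\\ rt_r+(r+1)t_{r+1}+\cdots+nt_n=n}} \bigl(\mu(r)\, t_r+\mu(r+1)\,t_{r+1} +\cdots +\mu(n)\, t_n\bigr),$$ where the sum runs over all tuples of non-negative integers $t_r,\ldots,t_n$ with $rt_r+(r+1)t_{r+1}+\cdots+nt_n=n$.
   Context: $p(m)$ denotes the number of partitions of the integer $m$, with $p(0)=1$ and $p(m)=0$ for $m<0$. $\mu$ is the classical Möbius function on positive integers: $\mu(m)=0$ if $m$ is divisible by the square of a prime, and $\mu(m)=(-1)^s$ if $m$ is a product of $s\geqslant 0$ distinct primes. When $n<r$ the list $t_r,\ldots,t_n$ is empty, and empty sums are $0$. *)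

theory Defs
  imports "HOL-Library.FuncSet" "HOL-Library.Multiset" "HOL-Computational_Algebra.Primes"
begin

definition partitions_of :: "int \<Rightarrow> nat multiset set" where
  "partitions_of m = {M. 0 \<notin># M \<and> int (sum_mset M) = m}"

definition partition_number :: "int \<Rightarrow> nat" where
  "partition_number m = card (partitions_of m)"

definition moebius :: "nat \<Rightarrow> int" where
  "moebius m =
    (if \<exists>q. prime q \<and> q\<^sup>2 dvd m then 0 else (- 1) ^ card {q. prime q \<and> q dvd m})"

text \<open>A tuple \<open>(t\<^sub>r, \<dots>, t\<^sub>n)\<close> is an extensional function on \<open>{r..n}\<close>, so that distinct
  functions are distinct tuples, and for \<open>n < r\<close> there is exactly one, the empty tuple.\<close>

definition weighted_tuples :: "nat \<Rightarrow> nat \<Rightarrow> (nat \<Rightarrow> nat) set" where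
  "weighted_tuples r n = {t \<in> {r..n} \<rightarrow>\<^sub>E UNIV. (\<Sum>i=r..n. i * t i) = n}"

text \<open>The partitions of \<open>m\<close> and, for \<open>r \<ge> 1\<close>, the weighted tuples form finite sets, so neither \<^const>\<open>card\<close> nor \<^const>\<open>sum\<close> falls back to its
  default value on infinite sets.\<close>

lemma finite_partitions_of: "finite (partitions_of m)"
proof -
  have "partitions_of m \<subseteq> (\<Union>k\<le>nat m. multisets_of_size {..nat m} k)"
  proof
    fix M assume "M \<in> partitions_of m"
    then have z: "0 \<notin># M" and s: "sum_mset M = nat m"
      unfolding partitions_of_def by (blast, force simp del: of_nat_sum_mset)
    have "size M \<le> sum_mset M"
      using z by (induction M) auto
    moreover have "x \<le> sum_mset M" if "x \<in># M" for x
      using that by (auto dest: multi_member_split)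
    ultimately show "M \<in> (\<Union>k\<le>nat m. multisets_of_size {..nat m} k)"
      using s by (auto simp: multisets_of_size_def)
  qed
  then show ?thesis
    by (rule finite_subset) (auto intro: finite_multisets_of_size)
qed

lemma finite_weighted_tuples:
  assumes "r \<ge> 1"
  shows "finite (weighted_tuples r n)"
proof (rule finite_subset)
  show "weighted_tuples r n \<subseteq> {r..n} \<rightarrow>\<^sub>E {..n}"
  proof
    fix t assume t: "t \<in> weighted_tuples r n"
    have "t i \<le> n" if i: "i \<in> {r..n}" for i
    proof -
      have "t i \<le> i * t i"
        using i assms by simp
      also have "\<dots> \<le> (\<Sum>i=r..n. i * t i)"
        using i by (intro member_le_sum) auto
      finally show ?thesis
        using t by (simp add: weighted_tuples_def)
    qed
    then show "t \<in> {r..n} \<rightarrow>\<^sub>E {..n}"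
      using t by (auto simp: weighted_tuples_def PiE_iff)
  qed
qed (auto intro: finite_PiE)

lemma partition_number_0: "partition_number 0 = 1"
proof -
  have "M = {#}" if "M \<in> partitions_of 0" for M
  proof (rule ccontr)
    assume "M \<noteq> {#}"
    then obtain x where "x \<in># M"
      by (auto elim: multiset_nonemptyE)
    moreover have "x = 0"
      using that \<open>x \<in># M\<close> unfolding partitions_of_def
      by (simp del: of_nat_sum_mset)
    ultimately show False
      using that by (simp add: partitions_of_def)
  qed
  then have "partitions_of 0 = {{#}}"
    by (auto simp: partitions_of_def)
  then show ?thesis
    by (simp add: partition_number_def)
qed

lemma partition_number_neg:
  assumes "m < 0"
  shows "partition_number m = 0"
proof -
  have "int (sum_mset M) \<noteq> m" for M
    using assms of_nat_0_le_iff[of "sum_mset M"] by linarith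
  then have "partitions_of m = {}"
    unfolding partitions_of_def by blast
  then show ?thesis
    by (simp add: partition_number_def)
qed

end

theory Submission
  imports Defs
begin

text \<open>Counting each part with multiplicity, \<open>\<Sum>\<^sub>M \<Sum>\<^sub>i \<mu>(i) t\<^sub>i\<close> over the partitions \<open>M\<close> of \<open>n\<close> into
  parts \<open>\<ge> r\<close> equals \<open>\<Sum>\<^sub>i\<^sub>,\<^sub>j \<mu>(i) p\<^sub>r(n - i j)\<close>, because the partitions with \<open>t\<^sub>i \<ge> j\<close> arise by
  adding \<open>j\<close> copies of \<open>i\<close> to a partition of \<open>n - i j\<close>. Grouping by \<open>m = i j\<close> leaves the sum of
  \<open>p\<^sub>r(n - m)\<close> weighted by the sum of \<open>\<mu>\<close> over the divisors \<open>\<ge> r\<close> of \<open>m\<close>, which is \<open>[m = 1]\<close> for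
  \<open>r = 1\<close> and \<open>[m = 1] - 1\<close> for \<open>r = 2\<close>. For \<open>r = 2\<close> the sum telescopes, as
  \<open>p\<^sub>2(k) = p(k) - p(k - 1)\<close>.\<close>

section \<open>Divisor sums of the Moebius function\<close>

lemma moebius_1: "moebius 1 = 1"
proof -
  have "\<not> (q dvd 1)" "\<not> (q\<^sup>2 dvd 1)" if "prime q" for q :: nat
    using that by (auto simp: not_prime_unit)
  then have "{q::nat. prime q \<and> q dvd 1} = {}" "\<not> (\<exists>q::nat. prime q \<and> q\<^sup>2 dvd 1)"
    by blast+
  then show ?thesis
    unfolding moebius_def by (simp only: card.empty if_False power_0)
qed

lemma moebius_eq_0:
  assumes "prime q" "q\<^sup>2 dvd d"
  shows "moebius d = 0"
  using assms unfolding moebius_def by auto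

text \<open>The factor \<open>p\<close> adds one new prime divisor, and it creates no new square
  divisor because \<open>p\<close> does not divide \<open>d\<close>. If \<open>d\<close> is not
  squarefree, both sides vanish.\<close>

lemma moebius_prime_mult:
  assumes p: "prime p" and nd: "\<not> p dvd d"
  shows "moebius (p * d) = - moebius d"
proof -
  have "d > 0"
    using nd by (cases d) auto
  then have fin: "finite {q. prime q \<and> q dvd d}"
    by (auto intro: finite_subset[OF _ finite_divisors_nat])
  have "{q. prime q \<and> q dvd p * d} = insert p {q. prime q \<and> q dvd d}"
    using p by (auto simp: prime_dvd_mult_iff primes_dvd_imp_eq)
  then have card: "card {q. prime q \<and> q dvd p * d} = Suc (card {q. prime q \<and> q dvd d})"
    using fin nd by simp
  have "q\<^sup>2 dvd p * d \<longleftrightarrow> q\<^sup>2 dvd d" if q: "prime q" for q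
  proof (cases "q = p")
    case True
    then show ?thesis
      using p nd by (auto simp: power2_eq_square dest: dvd_mult_left)
  next
    case False
    then have "coprime (q\<^sup>2) p"
      using p q by (simp add: primes_coprime)
    then show ?thesis
      by (simp add: coprime_dvd_mult_right_iff)
  qed
  then have "(\<exists>q. prime q \<and> q\<^sup>2 dvd p * d) \<longleftrightarrow> (\<exists>q. prime q \<and> q\<^sup>2 dvd d)"
    by blast
  then show ?thesis
    unfolding moebius_def card by simp
qed

text \<open>For a prime \<open>p\<close> dividing \<open>m > 1\<close>, each divisor
  \<open>d\<close> prime to \<open>p\<close> cancels against \<open>p * d\<close>. The remaining
  divisors are multiples of the square of \<open>p\<close> and contribute 0.\<close>

lemma sum_moebius_divisors:
  assumes "m > 0"
  shows "(\<Sum>d | d dvd m. moebius d) = (if m = 1 then 1 else 0)"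
proof (cases "m = 1")
  case True
  have "{d. d dvd (1::nat)} = {1}"
    by auto
  then show ?thesis
    unfolding True using moebius_1 by (simp del: One_nat_def)
next
  case False
  then obtain p where p: "prime p" "p dvd m"
    using prime_factor_nat by blast
  define A where "A = {d. d dvd m \<and> \<not> p dvd d}"
  define B where "B = {d. d dvd m \<and> p dvd d}"
  have fin: "finite A" "finite B"
    unfolding A_def B_def using assms
    by (auto intro: finite_subset[OF _ finite_divisors_nat])
  \<comment> \<open>The image of \<open>A\<close> may be a proper subset of \<open>B\<close>: it
    misses the products \<open>p * e\<close> with \<open>p\<close> dividing \<open>e\<close>, where
    \<open>moebius\<close> is 0.\<close>
  have "(\<Sum>d\<in>(\<lambda>d. p * d) ` A. moebius d) = (\<Sum>d\<in>B. moebius d)"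
  proof (rule sum.mono_neutral_left)
    show "(\<lambda>d. p * d) ` A \<subseteq> B"
      using p by (auto simp: A_def B_def intro!: divides_mult prime_imp_coprime)
    show "\<forall>d\<in>B - (\<lambda>d. p * d) ` A. moebius d = 0"
    proof
      fix d assume d: "d \<in> B - (\<lambda>d. p * d) ` A"
      then obtain e where e: "d = p * e"
        by (auto simp: B_def)
      then have "e dvd m" "e \<notin> A"
        using d by (auto simp: B_def dest: dvd_mult_right)
      then have "p\<^sup>2 dvd d"
        unfolding e by (auto simp: A_def power2_eq_square)
      then show "moebius d = 0"
        using p moebius_eq_0 by blast
    qed
  qed (fact fin)
  moreover have "(\<Sum>d\<in>(\<lambda>d. p * d) ` A. moebius d) = (\<Sum>d\<in>A. moebius (p * d))"
    using p by (subst sum.reindex) (auto simp: inj_on_def)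
  moreover have "\<dots> = - (\<Sum>d\<in>A. moebius d)"
    using p by (simp add: moebius_prime_mult A_def sum_negf)
  moreover have "{d. d dvd m} = A \<union> B" "A \<inter> B = {}"
    by (auto simp: A_def B_def)
  ultimately show ?thesis
    using fin False by (simp add: sum.union_disjoint)
qed

section \<open>Partitions with parts bounded below, and their tuples of multiplicities\<close>

definition partitions_ge :: "nat \<Rightarrow> nat \<Rightarrow> nat multiset set" where
  "partitions_ge r n = {M. (\<forall>i\<in>#M. r \<le> i) \<and> sum_mset M = n}"

lemma partitions_of_eq_partitions_ge: "partitions_of (int n) = partitions_ge 1 n"
  unfolding partitions_of_def partitions_ge_def
  by (auto simp del: of_nat_sum_mset simp: Suc_le_eq intro!: gr0I)

lemma finite_partitions_ge:
  assumes "r \<ge> 1"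
  shows "finite (partitions_ge r n)"
proof (rule finite_subset)
  show "partitions_ge r n \<subseteq> partitions_of (int n)"
    unfolding partitions_of_eq_partitions_ge using assms
    by (auto simp: partitions_ge_def)
qed (rule finite_partitions_of)

text \<open>The set \<open>S\<close> may exceed the support, since absent elements have count 0.
  This permits \<open>S = {r..n}\<close>, the index range of the tuples.\<close>

lemma sum_mset_eq_sum_count:
  fixes M :: "nat multiset"
  assumes "finite S" "set_mset M \<subseteq> S"
  shows "sum_mset M = (\<Sum>i\<in>S. i * count M i)"
  using assms(2)
proof (induction M)
  case (add x M)
  have "(\<Sum>i\<in>S. i * count (add_mset x M) i) = (\<Sum>i\<in>S. i * count M i + (if i = x then x else 0))"
    by (intro sum.cong) auto
  also have "\<dots> = (\<Sum>i\<in>S. i * count M i) + x"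
    using add.prems assms(1) by (simp add: sum.distrib sum.delta')
  finally show ?case
    using add by simp
qed simp

lemma partitions_ge_subset:
  assumes "M \<in> partitions_ge r n"
  shows "set_mset M \<subseteq> {r..n}"
  using assms by (auto simp: partitions_ge_def dest: multi_member_split)

text \<open>A partition is determined by its multiplicities. All parts lie in \<open>{r..n}\<close>,
  so the restriction loses nothing while making the function extensional.\<close>

lemma bij_betw_partitions_ge_weighted_tuples:
  assumes "r \<ge> 1"
  shows "bij_betw (\<lambda>M. restrict (count M) {r..n}) (partitions_ge r n) (weighted_tuples r n)"
proof (rule bij_betw_byWitness)
  define g :: "(nat \<Rightarrow> nat) \<Rightarrow> nat multiset" where "g = (\<lambda>t. \<Sum>i=r..n. replicate_mset (t i) i)"
  have count_g: "count (g t) i = (if i \<in> {r..n} then t i else 0)" for t i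
    unfolding g_def by (auto simp: count_sum)
  have set_g: "set_mset (g t) \<subseteq> {r..n}" for t
    by (auto simp: count_g simp flip: count_greater_zero_iff split: if_splits)
  show "\<forall>M\<in>partitions_ge r n. g (restrict (count M) {r..n}) = M"
    using partitions_ge_subset
    by (fastforce intro!: multiset_eqI simp: count_g not_in_iff[symmetric] simp del: atLeastAtMost_iff)
  show "\<forall>t\<in>weighted_tuples r n. restrict (count (g t)) {r..n} = t"
    by (auto simp: weighted_tuples_def count_g PiE_iff extensional_def)
  show "(\<lambda>M. restrict (count M) {r..n}) ` partitions_ge r n \<subseteq> weighted_tuples r n"
  proof safe
    fix M assume M: "M \<in> partitions_ge r n"
    then show "restrict (count M) {r..n} \<in> weighted_tuples r n"
      using sum_mset_eq_sum_count[OF _ partitions_ge_subset[OF M]]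
      by (simp add: weighted_tuples_def partitions_ge_def)
  qed
  show "g ` weighted_tuples r n \<subseteq> partitions_ge r n"
  proof safe
    fix t assume t: "t \<in> weighted_tuples r n"
    then show "g t \<in> partitions_ge r n"
      using sum_mset_eq_sum_count[OF _ set_g, of t] set_g[of t]
      by (auto simp: weighted_tuples_def partitions_ge_def count_g)
  qed
qed

section \<open>Counting the occurrences of a part over all partitions\<close>

text \<open>Adding \<open>j\<close> copies of \<open>i\<close> is inverted by removing them. The
  bound \<open>i * j \<le> n\<close> keeps the natural subtraction from truncating.\<close>

lemma card_partitions_ge_count:
  assumes "r \<le> i" "i * j \<le> n"
  shows "card {M \<in> partitions_ge r n. j \<le> count M i} = card (partitions_ge r (n - i * j))"
proof -
  have "bij_betw (\<lambda>M. M + replicate_mset j i) (partitions_ge r (n - i * j))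
      {M \<in> partitions_ge r n. j \<le> count M i}"
  proof (rule bij_betw_byWitness[where f' = "\<lambda>M. M - replicate_mset j i"])
    show "\<forall>M\<in>{M \<in> partitions_ge r n. j \<le> count M i}. M - replicate_mset j i + replicate_mset j i = M"
      by (simp add: count_le_replicate_mset_subset_eq)
    show "(\<lambda>M. M + replicate_mset j i) ` partitions_ge r (n - i * j)
        \<subseteq> {M \<in> partitions_ge r n. j \<le> count M i}"
      using assms by (auto simp: partitions_ge_def mult.commute split: if_splits)
    show "(\<lambda>M. M - replicate_mset j i) ` {M \<in> partitions_ge r n. j \<le> count M i}
        \<subseteq> partitions_ge r (n - i * j)"
    proof safe
      fix M assume M: "M \<in> partitions_ge r n" "j \<le> count M i"
      then have "sum_mset (M - replicate_mset j i) = n - i * j"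
        by (simp add: partitions_ge_def count_le_replicate_mset_subset_eq sum_mset_diff mult.commute)
      then show "M - replicate_mset j i \<in> partitions_ge r (n - i * j)"
        using M by (auto simp: partitions_ge_def dest: in_diffD)
    qed
  qed simp
  then show ?thesis
    by (simp add: bij_betw_same_card)
qed

lemma mult_count_le:
  assumes "M \<in> partitions_ge r n"
  shows "i * count M i \<le> n"
proof -
  have "replicate_mset (count M i) i \<subseteq># M"
    by (simp flip: count_le_replicate_mset_subset_eq)
  then obtain N where "M = replicate_mset (count M i) i + N"
    by (auto simp: mset_subset_eq_exists_conv)
  then have "sum_mset M = count M i * i + sum_mset N"
    by (metis sum_mset.union sum_mset_replicate_mset of_nat_id)
  then show ?thesis
    using assms by (simp add: partitions_ge_def mult.commute)
qed

text \<open>A count is the number of \<open>j \<ge> 1\<close> not exceeding it. Exchanging the sums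
  leaves, for each \<open>j\<close>, the partitions with at least \<open>j\<close> copies of
  \<open>i\<close>; then \<open>m = i * j\<close>.\<close>

lemma sum_count_partitions_ge:
  assumes "r \<ge> 1" "r \<le> i"
  shows "(\<Sum>M\<in>partitions_ge r n. count M i) =
    (\<Sum>m\<in>{m\<in>{1..n}. i dvd m}. card (partitions_ge r (n - m)))"
proof -
  have fin: "finite (partitions_ge r n)"
    using assms finite_partitions_ge by blast
  have "(\<Sum>M\<in>partitions_ge r n. count M i) =
      (\<Sum>M\<in>partitions_ge r n. \<Sum>j\<in>{j\<in>{1..n}. i * j \<le> n}. if j \<le> count M i then 1 else 0)"
  proof (rule sum.cong[OF refl])
    fix M assume M: "M \<in> partitions_ge r n"
    \<comment> \<open>The range of \<open>j\<close> is independent of \<open>M\<close>, as the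
      exchange of sums requires; by \<open>mult_count_le\<close> it still contains every positive
      \<open>j \<le> count M i\<close>.\<close>
    have "{j\<in>{1..n}. i * j \<le> n} \<inter> {j. j \<le> count M i} = {1..count M i}"
    proof -
      have "i * j \<le> n \<and> j \<le> n" if "j \<le> count M i" for j
      proof -
        have "i * j \<le> i * count M i"
          using that by simp
        then have "i * j \<le> n"
          using mult_count_le[OF M, of i] by linarith
        moreover have "j \<le> i * j"
          using assms by simp
        ultimately show ?thesis
          by linarith
      qed
      then show ?thesis
        by auto
    qed
    then show "count M i = (\<Sum>j\<in>{j\<in>{1..n}. i * j \<le> n}. if j \<le> count M i then 1 else 0)"
      by (simp flip: sum.inter_restrict add: sum.If_cases)
  qed
  also have "\<dots> = (\<Sum>j\<in>{j\<in>{1..n}. i * j \<le> n}. card {M \<in> partitions_ge r n. j \<le> count M i})"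
    using fin by (subst sum.swap) (simp add: sum.If_cases Int_def)
  also have "\<dots> = (\<Sum>j\<in>{j\<in>{1..n}. i * j \<le> n}. card (partitions_ge r (n - i * j)))"
    using assms by (intro sum.cong refl card_partitions_ge_count) auto
  also have "\<dots> = (\<Sum>m\<in>{m\<in>{1..n}. i dvd m}. card (partitions_ge r (n - m)))"
  proof (rule sum.reindex_bij_witness[where i = "\<lambda>m. m div i" and j = "\<lambda>j. i * j"])
    fix m assume m: "m \<in> {m\<in>{1..n}. i dvd m}"
    then obtain k where k: "m = i * k"
      by auto
    have "k \<le> i * k"
      using assms by simp
    then show "m div i \<in> {j\<in>{1..n}. i * j \<le> n}"
      using m assms le_trans[OF \<open>k \<le> i * k\<close>] unfolding k by (auto simp: Suc_le_eq)
  qed (use assms in \<open>auto simp: Suc_le_eq\<close>)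
  finally show ?thesis .
qed

lemma sum_moebius_weighted_tuples:
  assumes r: "r \<ge> 1"
  shows "(\<Sum>t\<in>weighted_tuples r n. \<Sum>i=r..n. moebius i * int (t i)) =
    (\<Sum>m=1..n. int (card (partitions_ge r (n - m))) * (\<Sum>i | i dvd m \<and> r \<le> i. moebius i))"
proof -
  have "(\<Sum>t\<in>weighted_tuples r n. \<Sum>i=r..n. moebius i * int (t i)) =
      (\<Sum>M\<in>partitions_ge r n. \<Sum>i=r..n. moebius i * int (count M i))"
    by (subst sum.reindex_bij_betw[OF bij_betw_partitions_ge_weighted_tuples[OF r], symmetric]) simp
  also have "\<dots> = (\<Sum>i=r..n. moebius i * int (\<Sum>M\<in>partitions_ge r n. count M i))"
    by (subst sum.swap) (simp add: sum_distrib_left)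
  also have "\<dots> = (\<Sum>i=r..n. \<Sum>m\<in>{m\<in>{1..n}. i dvd m}. int (card (partitions_ge r (n - m))) * moebius i)"
    using r by (intro sum.cong refl) (simp add: sum_count_partitions_ge sum_distrib_left mult.commute)
  also have "\<dots> = (\<Sum>m=1..n. \<Sum>i\<in>{i\<in>{r..n}. i dvd m}. int (card (partitions_ge r (n - m))) * moebius i)"
    by (rule sum.swap_restrict) auto
  also have "\<dots> = (\<Sum>m=1..n. int (card (partitions_ge r (n - m))) * (\<Sum>i | i dvd m \<and> r \<le> i. moebius i))"
  proof (rule sum.cong[OF refl])
    fix m assume m: "m \<in> {1..n}"
    then have "{i\<in>{r..n}. i dvd m} = {i. i dvd m \<and> r \<le> i}"
      by (auto dest: dvd_imp_le)
    then show "(\<Sum>i\<in>{i\<in>{r..n}. i dvd m}. int (card (partitions_ge r (n - m))) * moebius i) =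
        int (card (partitions_ge r (n - m))) * (\<Sum>i | i dvd m \<and> r \<le> i. moebius i)"
      by (simp add: sum_distrib_left)
  qed
  finally show ?thesis .
qed

section \<open>Raising the lower bound on the parts\<close>

text \<open>Either \<open>r\<close> does not occur, so all parts are at least \<open>Suc r\<close>,
  or one copy of \<open>r\<close> can be removed.\<close>

lemma card_partitions_ge_Suc:
  assumes "r \<ge> 1" "r \<le> n"
  shows "card (partitions_ge r n) = card (partitions_ge (Suc r) n) + card (partitions_ge r (n - r))"
proof -
  have "partitions_ge r n = partitions_ge (Suc r) n \<union> {M \<in> partitions_ge r n. 1 \<le> count M r}"
    by (auto simp: partitions_ge_def Suc_le_eq count_greater_zero_iff intro: le_neq_trans Suc_leD)
  moreover have "partitions_ge (Suc r) n \<inter> {M \<in> partitions_ge r n. 1 \<le> count M r} = {}"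
    by (auto simp: partitions_ge_def)
  ultimately have "card (partitions_ge r n) =
      card (partitions_ge (Suc r) n) + card {M \<in> partitions_ge r n. 1 \<le> count M r}"
    using assms by (metis card_Un_disjoint finite_Un finite_partitions_ge)
  then show ?thesis
    using assms card_partitions_ge_count[of r r 1 n] by simp
qed

lemma partitions_ge_0:
  assumes "r \<ge> 1"
  shows "partitions_ge r 0 = {{#}}"
proof -
  have "M = {#}" if "M \<in> partitions_ge r 0" for M
    using partitions_ge_subset[OF that] assms by simp
  then show ?thesis
    by (auto simp: partitions_ge_def)
qed

text \<open>By \<open>card_partitions_ge_Suc\<close> with \<open>r = 1\<close>, each summand with
  \<open>k \<ge> 1\<close> is a difference of consecutive values of the right-hand side; both sides
  start at 1.\<close>

lemma sum_card_partitions_ge_2: "(\<Sum>k\<le>n. card (partitions_ge 2 k)) = card (partitions_ge 1 n)"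
proof (induction n)
  case 0
  show ?case
    by (simp add: partitions_ge_0)
next
  case (Suc n)
  then show ?case
    using card_partitions_ge_Suc[of 1 "Suc n"] by (simp add: numeral_2_eq_2)
qed

theorem corollary1p2:
  fixes n r :: nat
  assumes "r \<in> {1, 2}"
  shows "int (partition_number (int n - int r)) =
    (- 1) ^ (r - 1) *
      (\<Sum>t\<in>weighted_tuples r n. \<Sum>i=r..n. moebius i * int (t i))"
proof -
  define S where "S = (\<Sum>t\<in>weighted_tuples r n. \<Sum>i=r..n. moebius i * int (t i))"
  \<comment> \<open>For \<open>k > n\<close> the integer argument is negative and the value is 0,
    whereas the natural \<open>n - k\<close> would truncate to 0 and give 1.\<close>
  have number: "partition_number (int n - int k) = (if k \<le> n then card (partitions_ge 1 (n - k)) else 0)" for k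
    by (auto simp: partition_number_def partitions_of_eq_partitions_ge of_nat_diff[symmetric]
        simp del: of_nat_diff intro: partition_number_neg[unfolded partition_number_def])
  have S: "S = (\<Sum>m=1..n. int (card (partitions_ge r (n - m))) * (\<Sum>i | i dvd m \<and> r \<le> i. moebius i))"
    unfolding S_def using assms by (intro sum_moebius_weighted_tuples) auto
  have delta: "(\<Sum>m=1..n. f m * (if m = 1 then 1 else 0)) = (if 1 \<le> n then f 1 else 0)"
    for f :: "nat \<Rightarrow> int"
  proof -
    have "(\<Sum>m=1..n. f m * (if m = 1 then 1 else 0)) = (\<Sum>m=1..n. if m = 1 then f m else 0)"
      by (intro sum.cong) auto
    then show ?thesis
      by (simp add: sum.delta)
  qed
  from assms consider "r = 1" | "r = 2"
    by auto
  then have "int (partition_number (int n - int r)) = (- 1) ^ (r - 1) * S"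
  proof cases
    case 1
    have "(\<Sum>i | i dvd m \<and> 1 \<le> i. moebius i) = (if m = 1 then 1 else 0)" if "m \<in> {1..n}" for m
    proof -
      have "{i. i dvd m \<and> 1 \<le> i} = {i. i dvd m}"
        using that by (auto intro!: Suc_leI gr0I)
      then show ?thesis
        using sum_moebius_divisors[of m] that by simp
    qed
    then have "S = (\<Sum>m=1..n. int (card (partitions_ge 1 (n - m))) * (if m = 1 then 1 else 0))"
      unfolding S 1 by (intro sum.cong refl arg_cong2[where f = "(*)"])
    then have "S = (if 1 \<le> n then int (card (partitions_ge 1 (n - 1))) else 0)"
      unfolding delta .
    then show ?thesis
      using number[of 1] 1 by simp
  next
    case 2
    have "(\<Sum>i | i dvd m \<and> 2 \<le> i. moebius i) = (if m = 1 then 1 else 0) - 1" if "m \<in> {1..n}" for m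
    proof -
      \<comment> \<open>Leaving out the divisor 1 removes \<open>moebius 1 = 1\<close> from the full
        divisor sum.\<close>
      have "{i. i dvd m} = insert 1 {i. i dvd m \<and> 2 \<le> i}"
        using that by (auto simp: numeral_2_eq_2 Suc_le_eq intro: gr0I)
      moreover have "finite {i. i dvd m \<and> 2 \<le> i}"
        using that by (auto intro: finite_subset[OF _ finite_divisors_nat[of m]])
      ultimately have "(\<Sum>i | i dvd m. moebius i) = moebius 1 + (\<Sum>i | i dvd m \<and> 2 \<le> i. moebius i)"
        by simp
      then show ?thesis
        using sum_moebius_divisors[of m] moebius_1 that by simp
    qed
    then have "S = (\<Sum>m=1..n. int (card (partitions_ge 2 (n - m))) * ((if m = 1 then 1 else 0) - 1))"
      unfolding S 2 by (intro sum.cong refl arg_cong2[where f = "(*)"])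
    also have "\<dots> = (if 1 \<le> n then int (card (partitions_ge 2 (n - 1))) else 0) -
        int (\<Sum>m=1..n. card (partitions_ge 2 (n - m)))"
      by (simp only: right_diff_distrib sum_subtractf delta mult_1_right of_nat_sum)
    finally have S2: "S = \<dots>" .
    show ?thesis
    proof (cases n)
      case 0
      then show ?thesis
        using S2 number[of 2] 2 by simp
    next
      case (Suc k)
      \<comment> \<open>The substitution \<open>j = n - m\<close> maps \<open>{1..n}\<close> onto
        \<open>{0..k}\<close> because \<open>n = Suc k\<close>.\<close>
      have "(\<Sum>m=1..n. card (partitions_ge 2 (n - m))) = (\<Sum>j\<le>k. card (partitions_ge 2 j))"
        by (rule sum.reindex_bij_witness[where i = "\<lambda>j. n - j" and j = "\<lambda>m. n - m"])
          (auto simp: Suc)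
      also have "\<dots> = card (partitions_ge 1 k)"
        by (rule sum_card_partitions_ge_2)
      finally have S3: "S = int (card (partitions_ge 2 k)) - int (card (partitions_ge 1 k))"
        using S2 Suc by simp
      then have "- S = int (partition_number (int n - int 2))"
      proof (cases k)
        \<comment> \<open>Here \<open>n = 1\<close>: both counts in \<open>S3\<close> are 1,
          matching the value 0 of \<open>partition_number\<close> at -1.\<close>
        case 0
        then show ?thesis
          using S3 number[of 2] Suc by (simp add: partitions_ge_0)
      next
        \<comment> \<open>The recursion for \<open>r = 1\<close> turns the difference in
          \<open>S3\<close> into minus the number of partitions of
          \<open>k - 1 = n - 2\<close>.\<close>
        case (Suc l)
        then show ?thesis
          using S3 number[of 2] \<open>n = Suc k\<close> card_partitions_ge_Suc[of 1 k]
          by (simp add: numeral_2_eq_2)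
      qed
      then show ?thesis
        using 2 by simp
    qed
  qed
  then show ?thesis
    unfolding S_def .
qed

end
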